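(* The property ``the graph is connected'' has threshold function $\frac{\log(n)}{n^2}$ in $\mathbb{G}(n,p\, ; \,\binom{[n]}{3})$; that is, \[ \lim_{n\to\infty}\mathbb{P}\left(\mathbb{G}\left(n,p_n\,;\,\binom{[n]}{3}\right)\text{ is connected}\right)=\begin{cases}0,& \text{if } p_n\ll \frac{\log n}{n^2},\\ 1,&\text{if } p_n\gg \frac{\log n}{n^2}.\end{cases} \]
   Context: $\binom{[n]}{3}$ denotes the collection of all 3-element subsets of $[n]=\{1,\dots,n\}$. For $p\in[0,1]$, the random multigraph $\mathbb{G}(n,p\,;\,\binom{[n]}{3})$ is generated as follows: start with the empty graph on vertex set $[n]$; for every $H\in\binom{[n]}{3}$, choose a 2-element subset $\{i,j\}\subset H$ uniformly at random and then add an edge between $i$ and $j$ with probability $p$; all choices and coin flips are mutually independent. $a_n\ll b_n$ (equivalently $b_n\gg a_n$) means $a_n/b_n\to 0$. *)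

theory Defs
  imports "HOL-Probability.Product_PMF" "Graph_Theory.Digraph_Component"
begin

text \<open>
  Conjunct one ensures that the quotient is eventually a genuine one: HOL totalises division
  by \<open>x / 0 = 0\<close>, so without it every sequence would be \<open>\<lless>\<close> the zero sequence.
\<close>

definition much_less :: "(nat \<Rightarrow> real) \<Rightarrow> (nat \<Rightarrow> real) \<Rightarrow> bool" (infix "\<lless>" 50) where
  "a \<lless> b \<longleftrightarrow> (\<forall>\<^sub>F n in sequentially. b n \<noteq> 0) \<and> (\<lambda>n. a n / b n) \<longlonglongrightarrow> 0"

definition subsets_of_size :: "nat \<Rightarrow> 'a set \<Rightarrow> 'a set set" where
  "subsets_of_size k A = {H. H \<subseteq> A \<and> card H = k}"

text \<open>
  The outcome for a single hyperedge \<open>H\<close>: \<open>Some e\<close> if the edge \<open>e\<close> is added,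
  \<open>None\<close> if the coin flip fails.
\<close>

definition hyperedge_choice :: "real \<Rightarrow> nat set \<Rightarrow> nat set option pmf" where
  "hyperedge_choice p H =
     do {
       e \<leftarrow> pmf_of_set (subsets_of_size 2 H);
       b \<leftarrow> bernoulli_pmf p;
       return_pmf (if b then Some e else None)
     }"

text \<open>
  The multigraph on \<open>{1..n}\<close> determined by the outcomes \<open>c H\<close>. An edge is a pair of the
  hyperedge it comes from and its set of endpoints, so equal 2-sets obtained from different
  hyperedges are parallel edges. The library graphs are directed; the
  orientation from the smaller to the larger endpoint is immaterial, because
  \<^const>\<open>Digraph_Component.connected\<close> is connectedness of the symmetric closure.
\<close>

definition multigraph_of ::
  "nat \<Rightarrow> nat set set \<Rightarrow> (nat set \<Rightarrow> nat set option) \<Rightarrow> (nat, nat set \<times> nat set) pre_digraph"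
where
  "multigraph_of n \<H> c =
     \<lparr> verts = {1..n},
       arcs = {(H, e). H \<in> \<H> \<and> c H = Some e},
       tail = (\<lambda>(H, e). Min e),
       head = (\<lambda>(H, e). Max e) \<rparr>"

text \<open>
  \<open>\<H>\<close> is meant to be a set of subsets of \<open>{1..n}\<close>, each with at least two elements, and
  \<open>p\<close> to lie in \<open>{0..1}\<close>. The product \<^const>\<open>Pi_pmf\<close> makes the outcomes for different
  hyperedges independent.
\<close>

definition random_multigraph ::
  "nat \<Rightarrow> real \<Rightarrow> nat set set \<Rightarrow> (nat, nat set \<times> nat set) pre_digraph pmf"
where
  "random_multigraph n p \<H> = map_pmf (multigraph_of n \<H>) (Pi_pmf \<H> None (hyperedge_choice p))"

end

theory Submission
  imports Defs
begin

text \<open>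
  For a set \<open>F\<close> of potential edges, the probability that no edge of \<open>F\<close> appears is the product
  over all triples \<open>H\<close> of \<open>1 - p k / 3\<close>, where \<open>k\<close> is the number of pairs of \<open>H\<close> lying in \<open>F\<close>.
  A triple that meets both sides of a vertex cut has exactly two crossing pairs, so the
  cut stays empty with probability \<open>(1 - 2p/3) ^ K\<close>, \<open>K\<close> being the number of such triples.

  Below the threshold the second moment method yields an isolated vertex: a vertex is isolated with
  probability at least \<open>(1 - 2p/3) ^ n\<^sup>2\<close>, much larger than \<open>1/n\<close>, and isolation of two
  vertices is nearly independent because only \<open>n - 2\<close> triples contain both. Above the
  threshold, take the union bound over the cuts whose smaller side \<open>S\<close> has at most \<open>n/2\<close>
  vertices: at least \<open>|S| n\<^sup>2 / 16\<close> triples cross such a cut, so with \<open>y = exp (- p n\<^sup>2 / 24)\<close> the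
  total failure probability is at most the sum of \<open>y ^ |S|\<close> over nonempty \<open>S\<close>, that is
  \<open>(1 + y) ^ n - 1\<close>.
\<close>

section \<open>Connectivity in terms of cuts\<close>

lemma connected_iff_crossing:
  assumes "wf_digraph G"
  shows "Digraph_Component.connected G \<longleftrightarrow> verts G \<noteq> {} \<and>
    (\<forall>S. S \<subset> verts G \<longrightarrow> S \<noteq> {} \<longrightarrow> (\<exists>a\<in>arcs G. (tail G a \<in> S) \<noteq> (head G a \<in> S)))"
    (is "_ \<longleftrightarrow> _ \<and> ?cuts")
proof -
  interpret wf_digraph G by fact
  let ?r = "\<Union>a\<in>arcs G. {(tail G a, head G a), (head G a, tail G a)}"
  have r_verts: "y \<in> verts G" if "(x, y) \<in> ?r" for x y
    using that by auto
  have conn: "Digraph_Component.connected G \<longleftrightarrow> verts G \<noteq> {} \<and>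
      (\<forall>u\<in>verts G. \<forall>v\<in>verts G. (u, v) \<in> rtrancl_on (verts G) ?r)"
    by (auto simp: Digraph_Component.connected_def strongly_connected_def reachable_def
        parcs_mk_symmetric)
  have cutsI: "?cuts" if all: "\<forall>u\<in>verts G. \<forall>v\<in>verts G. (u, v) \<in> rtrancl_on (verts G) ?r"
  proof (intro allI impI, rule ccontr)
    fix S assume S: "S \<subset> verts G" "S \<noteq> {}"
      and no: "\<not> (\<exists>a\<in>arcs G. (tail G a \<in> S) \<noteq> (head G a \<in> S))"
    from S obtain u v where uv: "u \<in> S" "v \<in> verts G" "v \<notin> S" by blast
    with S all have "(u, v) \<in> rtrancl_on (verts G) ?r" by blast
    then have "v \<in> S"
      by (induction rule: rtrancl_on_induct) (use uv no in auto)
    with uv show False by blast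
  qed
  have pathI: "(u, v) \<in> rtrancl_on (verts G) ?r"
    if cuts: "?cuts" and uv: "u \<in> verts G" "v \<in> verts G" for u v
  proof (rule ccontr)
    assume nr: "(u, v) \<notin> rtrancl_on (verts G) ?r"
    \<comment> \<open>The set reachable from \<open>u\<close> contains \<open>u\<close> but not
      \<open>v\<close>, so some arc crosses it. Since \<open>?r\<close> contains each arc in both
      directions, that arc leads from a reachable vertex to an unreachable one, a
      contradiction.\<close>
    define S where "S = {w. (u, w) \<in> rtrancl_on (verts G) ?r}"
    have "S \<subseteq> verts G" unfolding S_def using in_rtrancl_on_in_F(2) by fast
    moreover have "v \<notin> S" "u \<in> S" using nr uv by (auto simp: S_def)
    ultimately obtain a where a: "a \<in> arcs G" "(tail G a \<in> S) \<noteq> (head G a \<in> S)"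
      using cuts uv by (metis empty_iff psubsetI)
    have step: "y \<in> S" if "x \<in> S" "(x, y) \<in> ?r" for x y
      using that rtrancl_on_into_rtrancl_on[of u x "verts G" ?r y] r_verts[of x y]
      unfolding S_def mem_Collect_eq by iprover
    show False using a step[of "tail G a" "head G a"] step[of "head G a" "tail G a"] by auto
  qed
  have "(\<forall>u\<in>verts G. \<forall>v\<in>verts G. (u, v) \<in> rtrancl_on (verts G) ?r) \<longleftrightarrow> ?cuts"
    by (rule iffI[OF cutsI], assumption, intro ballI, rule pathI)
  then show ?thesis unfolding conn by (rule conj_cong[OF refl])
qed

text \<open>Used at two levels: for 2-sets it describes the edges of a cut, for triples the
  hyperedges that can produce such an edge. The other side of the cut is implicit, so no ambient
  vertex set appears.\<close>

definition crossing :: "'a set \<Rightarrow> 'a set set" where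
  "crossing S = {e. e \<inter> S \<noteq> {} \<and> \<not> e \<subseteq> S}"

definition avoids :: "'b set \<Rightarrow> 'a set \<Rightarrow> ('b \<Rightarrow> 'a option) set" where
  "avoids \<H> F = {c. \<forall>H\<in>\<H>. \<forall>e\<in>F. c H \<noteq> Some e}"

lemma avoids_Un: "avoids \<H> (F \<union> F') = avoids \<H> F \<inter> avoids \<H> F'"
  by (auto simp: avoids_def)

lemma finite_subsets_of_size: "finite A \<Longrightarrow> finite (subsets_of_size k A)"
  by (auto simp: subsets_of_size_def)

lemma card_subsets_of_size: "finite A \<Longrightarrow> card (subsets_of_size k A) = card A choose k"
  by (simp add: subsets_of_size_def n_subsets)

lemma subsets_of_size_2_nonempty:
  assumes "card H = 3"
  shows "subsets_of_size 2 H \<noteq> {}"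
proof -
  have "finite H" using assms card.infinite by fastforce
  with assms have "card (subsets_of_size 2 H) \<noteq> 0"
    by (simp add: card_subsets_of_size eval_nat_numeral)
  then show ?thesis by force
qed

lemma hyperedge_choice_support:
  assumes "card H = 3" "Some e \<in> set_pmf (hyperedge_choice p H)"
  shows "e \<subseteq> H" "card e = 2"
proof -
  have "finite H" using assms card.infinite by fastforce
  then have "set_pmf (pmf_of_set (subsets_of_size 2 H)) = subsets_of_size 2 H"
    using assms subsets_of_size_2_nonempty finite_subsets_of_size by (intro set_pmf_of_set) auto
  then have "e \<in> subsets_of_size 2 H"
    using assms(2) by (auto simp: hyperedge_choice_def split: if_splits)
  then show "e \<subseteq> H" "card e = 2" by (auto simp: subsets_of_size_def)
qed

text \<open>On the support every edge \<open>e\<close> is a 2-subset of its triple, hence equal to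
  \<open>{Min e, Max e}\<close>. So an arc has its ends on different sides of \<open>S\<close>
  exactly when \<open>e\<close> lies in \<open>crossing S\<close>. The condition
  \<open>n > 0\<close> reflects that the graph without vertices counts as disconnected.\<close>

lemma connected_multigraph_iff:
  assumes c: "c \<in> set_pmf (Pi_pmf (subsets_of_size 3 {1..n}) None (hyperedge_choice p))"
  shows "Digraph_Component.connected (multigraph_of n (subsets_of_size 3 {1..n}) c) \<longleftrightarrow>
    n > 0 \<and> (\<forall>S. S \<subset> {1..n} \<longrightarrow> S \<noteq> {} \<longrightarrow> c \<notin> avoids (subsets_of_size 3 {1..n}) (crossing S))"
proof -
  let ?\<H> = "subsets_of_size 3 {1..n}"
  let ?G = "multigraph_of n ?\<H> c"
  have edge: "e \<subseteq> {1..n}" "e = {Min e, Max e}" if "H \<in> ?\<H>" "c H = Some e" for H e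
  proof -
    have "finite ?\<H>" by (simp add: finite_subsets_of_size)
    with c that have "Some e \<in> set_pmf (hyperedge_choice p H)"
      by (force simp: set_Pi_pmf PiE_dflt_def)
    with that have e: "e \<subseteq> H" "card e = 2" and H: "H \<subseteq> {1..n}"
      using hyperedge_choice_support[of H e p] by (auto simp: subsets_of_size_def)
    then show "e \<subseteq> {1..n}" by blast
    from e obtain x y where "e = {x, y}" "x \<noteq> y" by (auto simp: card_2_iff)
    then show "e = {Min e, Max e}" by (auto simp: min_def max_def)
  qed
  have wf: "wf_digraph ?G"
  proof
    fix a assume "a \<in> arcs ?G"
    then obtain H e where a: "a = (H, e)" "H \<in> ?\<H>" "c H = Some e"
      by (auto simp: multigraph_of_def)
    have "Min e \<in> {1..n}" "Max e \<in> {1..n}"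
      using edge[OF a(2,3)] by blast+
    then show "tail ?G a \<in> verts ?G" "head ?G a \<in> verts ?G"
      using a(1) by (simp_all add: multigraph_of_def)
  qed
  have cross: "(Min e \<in> S) \<noteq> (Max e \<in> S) \<longleftrightarrow> e \<in> crossing S" if "H \<in> ?\<H>" "c H = Some e" for H e S
  proof -
    have "e \<in> crossing S \<longleftrightarrow> {Min e, Max e} \<in> crossing S" using edge(2)[OF that] by simp
    also have "\<dots> \<longleftrightarrow> (Min e \<in> S) \<noteq> (Max e \<in> S)" unfolding crossing_def by blast
    finally show ?thesis by simp
  qed
  have "(\<exists>a\<in>arcs ?G. (tail ?G a \<in> S) \<noteq> (head ?G a \<in> S)) \<longleftrightarrow> c \<notin> avoids ?\<H> (crossing S)" for S
  proof -
    have "(\<exists>a\<in>arcs ?G. (tail ?G a \<in> S) \<noteq> (head ?G a \<in> S)) \<longleftrightarrow>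
        (\<exists>H e. H \<in> ?\<H> \<and> c H = Some e \<and> (Min e \<in> S) \<noteq> (Max e \<in> S))"
      by (auto simp: multigraph_of_def)
    also have "\<dots> \<longleftrightarrow> (\<exists>H e. H \<in> ?\<H> \<and> c H = Some e \<and> e \<in> crossing S)"
      using cross by blast
    also have "\<dots> \<longleftrightarrow> c \<notin> avoids ?\<H> (crossing S)"
      unfolding avoids_def by blast
    finally show ?thesis .
  qed
  moreover have "verts ?G = {1..n}" by (simp add: multigraph_of_def)
  moreover have "{1..n} \<noteq> {} \<longleftrightarrow> n > 0" by auto
  ultimately show ?thesis
    using connected_iff_crossing[OF wf] by (simp only:)
qed

section \<open>Avoidance probabilities and the second moment inequality\<close>

lemma prob_hyperedge_choice:
  assumes p: "p \<in> {0..1}" and H: "card H = 3"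
  shows "measure_pmf.prob (hyperedge_choice p H) {x. \<forall>e\<in>F. x \<noteq> Some e} =
    1 - p * card (subsets_of_size 2 H \<inter> F) / 3"
proof -
  let ?P = "subsets_of_size 2 H"
  let ?g = "\<lambda>x. \<forall>e\<in>F. x \<noteq> Some e"
  have fH: "finite H" using assms card.infinite by fastforce
  then have fin: "finite ?P" by (rule finite_subsets_of_size)
  have cP: "card ?P = 3" using H fH by (simp add: card_subsets_of_size eval_nat_numeral)
  \<comment> \<open>Condition on the chosen pair \<open>e\<close>: avoidance fails only if
    \<open>e \<in> F\<close> and the coin succeeds. Averaging over the three equally likely pairs
    gives the formula.\<close>
  have inner: "pmf (map_pmf ?g (bernoulli_pmf p \<bind> (\<lambda>b. return_pmf (if b then Some e else None)))) True
      = 1 - p * indicator F e" for e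
    using p by (auto simp: map_bind_pmf pmf_bind indicator_def)
  have "measure_pmf.prob (hyperedge_choice p H) {x. ?g x} = pmf (map_pmf ?g (hyperedge_choice p H)) True"
    by (simp add: pmf_map vimage_def)
  also have "\<dots> = (\<integral>e. 1 - p * indicator F e \<partial>measure_pmf (pmf_of_set ?P))"
    unfolding hyperedge_choice_def map_bind_pmf[of _ "pmf_of_set _"] pmf_bind[of "pmf_of_set _"]
    by (simp only: inner)
  also have "\<dots> = (\<Sum>e\<in>?P. 1 - p * indicator F e) / 3"
    using fin subsets_of_size_2_nonempty[OF H] by (simp add: integral_pmf_of_set cP)
  also have "\<dots> = 1 - p * card (?P \<inter> F) / 3"
    unfolding indicator_def
    using fin by (simp add: sum_subtractf cP sum_distrib_left[symmetric] diff_divide_distrib)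
  finally show ?thesis .
qed

lemma prob_avoids:
  assumes p: "p \<in> {0..1}" and fin: "finite \<H>" and \<H>: "\<And>H. H \<in> \<H> \<Longrightarrow> card H = 3"
  shows "measure_pmf.prob (Pi_pmf \<H> None (hyperedge_choice p)) (avoids \<H> F) =
    (\<Prod>H\<in>\<H>. 1 - p * card (subsets_of_size 2 H \<inter> F) / 3)"
proof -
  \<comment> \<open>The event restricts each coordinate separately, so independence turns its
    probability into a product.\<close>
  have "avoids \<H> F = Pi \<H> (\<lambda>_. {x. \<forall>e\<in>F. x \<noteq> Some e})"
    by (auto simp: avoids_def)
  then show ?thesis
    using fin by (simp add: measure_Pi_pmf_Pi prob_hyperedge_choice[OF p \<H>])
qed

lemma subsets_of_size_2_triple:
  assumes "a \<noteq> b" "a \<noteq> c" "b \<noteq> c"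
  shows "subsets_of_size 2 {a, b, c} = {{a, b}, {a, c}, {b, c}}"
  using assms by (auto simp: subsets_of_size_def card_2_iff)

text \<open>A cut meeting a triple on both sides separates one vertex from the other two, and the
  crossing pairs are the two through the lone vertex.\<close>

lemma card_pairs_crossing:
  assumes "card H = 3"
  shows "card (subsets_of_size 2 H \<inter> crossing S) = (if H \<in> crossing S then 2 else 0)"
proof -
  obtain a b c where H: "H = {a, b, c}" "a \<noteq> b" "a \<noteq> c" "b \<noteq> c"
    using assms by (auto simp: card_3_iff)
  have "subsets_of_size 2 H \<inter> crossing S = (if (a \<in> S) \<noteq> (b \<in> S) then {{a, b}} else {}) \<union>
      (if (a \<in> S) \<noteq> (c \<in> S) then {{a, c}} else {}) \<union> (if (b \<in> S) \<noteq> (c \<in> S) then {{b, c}} else {})"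
    unfolding H(1) subsets_of_size_2_triple[OF H(2-4)] by (auto simp: crossing_def)
  moreover have "{a, b} \<noteq> {a, c}" "{a, b} \<noteq> {b, c}" "{a, c} \<noteq> {b, c}"
    using H by (auto simp: doubleton_eq_iff)
  ultimately show ?thesis
    unfolding H(1) by (auto simp: crossing_def)
qed

lemma card_pairs_le:
  assumes "card H = 3"
  shows "card (subsets_of_size 2 H \<inter> F) \<le> 3"
proof -
  have fH: "finite H" using assms card.infinite by fastforce
  have "card (subsets_of_size 2 H \<inter> F) \<le> card (subsets_of_size 2 H)"
    by (intro card_mono) (auto simp: finite_subsets_of_size fH)
  also have "\<dots> = 3" using assms fH by (simp add: card_subsets_of_size eval_nat_numeral)
  finally show ?thesis .
qed

text \<open>Chebyshev's argument for the sum \<open>X\<close> of the indicators, with mean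
  \<open>\<mu>\<close>: where no \<open>I v\<close> occurs, \<open>X = 0\<close> and the squared
  deviation is \<open>\<mu>\<^sup>2\<close>. The right-hand side is the variance of
  \<open>X\<close>. Multiplying by \<open>\<mu>\<^sup>2\<close> instead of dividing keeps the case
  \<open>\<mu> = 0\<close> meaningful.\<close>

lemma second_moment_pmf:
  fixes M :: "'a pmf"
  shows "(\<Sum>v\<in>V. measure_pmf.prob M (I v))\<^sup>2 * measure_pmf.prob M {x. \<forall>v\<in>V. x \<notin> I v} \<le>
    (\<Sum>u\<in>V. \<Sum>v\<in>V. measure_pmf.prob M (I u \<inter> I v)) - (\<Sum>v\<in>V. measure_pmf.prob M (I v))\<^sup>2"
proof -
  define \<mu> where "\<mu> = (\<Sum>v\<in>V. measure_pmf.prob M (I v))"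
  define X where "X = (\<lambda>x. \<Sum>v\<in>V. indicator (I v) x :: real)"
  define N where "N = {x. \<forall>v\<in>V. x \<notin> I v}"
  have int: "integrable (measure_pmf M) (indicator A :: _ \<Rightarrow> real)" for A
    by (simp add: less_top[symmetric])
  have X2: "(X x)\<^sup>2 = (\<Sum>u\<in>V. \<Sum>v\<in>V. indicator (I u \<inter> I v) x)" for x
    by (simp add: X_def power2_eq_square sum_product indicator_inter_arith)
  have intX: "integrable (measure_pmf M) X"
    unfolding X_def by (intro Bochner_Integration.integrable_sum int)
  have intX2: "integrable (measure_pmf M) (\<lambda>x. (X x)\<^sup>2)"
    unfolding X2 by (intro Bochner_Integration.integrable_sum int)
  have EX: "measure_pmf.expectation M X = \<mu>"
    unfolding X_def \<mu>_def using int by (subst Bochner_Integration.integral_sum) auto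
  have EX2: "measure_pmf.expectation M (\<lambda>x. (X x)\<^sup>2) =
      (\<Sum>u\<in>V. \<Sum>v\<in>V. measure_pmf.prob M (I u \<inter> I v))"
    unfolding X2 using int
    by (simp add: Bochner_Integration.integral_sum Bochner_Integration.integrable_sum)
  have "\<mu>\<^sup>2 * measure_pmf.prob M N = measure_pmf.expectation M (\<lambda>x. \<mu>\<^sup>2 * indicator N x)"
    by simp
  also have "\<dots> \<le> measure_pmf.expectation M (\<lambda>x. (X x)\<^sup>2 - 2 * \<mu> * X x + \<mu>\<^sup>2)"
  proof (rule integral_mono)
    show "integrable (measure_pmf M) (\<lambda>x. \<mu>\<^sup>2 * indicator N x)" using int by auto
    show "integrable (measure_pmf M) (\<lambda>x. (X x)\<^sup>2 - 2 * \<mu> * X x + \<mu>\<^sup>2)"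
      using intX intX2 by auto
    fix x
    show "\<mu>\<^sup>2 * indicator N x \<le> (X x)\<^sup>2 - 2 * \<mu> * X x + \<mu>\<^sup>2"
    proof (cases "x \<in> N")
      case True
      then have "X x = 0" by (auto simp: X_def N_def)
      then show ?thesis by (auto simp: indicator_def)
    next
      case False
      have "0 \<le> (X x - \<mu>)\<^sup>2" by simp
      then show ?thesis using False by (simp add: power2_diff algebra_simps)
    qed
  qed
  also have "\<dots> = measure_pmf.expectation M (\<lambda>x. (X x)\<^sup>2) - \<mu>\<^sup>2"
    using intX intX2 EX by (simp add: measure_pmf.prob_space power2_eq_square)
  finally show ?thesis unfolding EX2 by (simp add: \<mu>_def N_def)
qed

lemma prob_avoids_crossing:
  assumes "p \<in> {0..1}" "finite \<H>" and \<H>: "\<And>H. H \<in> \<H> \<Longrightarrow> card H = 3"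
  shows "measure_pmf.prob (Pi_pmf \<H> None (hyperedge_choice p)) (avoids \<H> (crossing S)) =
    (1 - 2 * p / 3) ^ card (\<H> \<inter> crossing S)"
proof -
  have "measure_pmf.prob (Pi_pmf \<H> None (hyperedge_choice p)) (avoids \<H> (crossing S)) =
      (\<Prod>H\<in>\<H>. if H \<in> crossing S then 1 - 2 * p / 3 else 1)"
    by (subst prob_avoids[OF assms(1,2) \<H>], assumption, intro prod.cong refl)
      (simp add: card_pairs_crossing \<H>)
  also have "\<dots> = (1 - 2 * p / 3) ^ card (\<H> \<inter> crossing S)"
    using assms(2) by (simp add: prod.If_cases)
  finally show ?thesis .
qed

section \<open>Counting triples through a vertex, through a pair and across a cut\<close>

lemma in_crossing_singleton: "card H = 3 \<Longrightarrow> H \<in> crossing {v} \<longleftrightarrow> v \<in> H"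
  by (auto simp: crossing_def subset_singleton_iff)

text \<open>The other two vertices determine the triple. Counting them as ordered pairs loses only a
  constant factor, which the threshold does not notice.\<close>

lemma card_triples_through_vertex:
  "card (subsets_of_size 3 {1..n} \<inter> crossing {v}) \<le> n\<^sup>2"
proof -
  have "subsets_of_size 3 {1..n} \<inter> crossing {v} \<subseteq> (\<lambda>(a, b). {v, a, b}) ` ({1..n} \<times> {1..n})"
  proof
    fix H assume H: "H \<in> subsets_of_size 3 {1..n} \<inter> crossing {v}"
    then have "card H = 3" "v \<in> H" "H \<subseteq> {1..n}"
      by (auto simp: subsets_of_size_def in_crossing_singleton)
    moreover then have "card (H - {v}) = 2" by simp
    then obtain a b where "H - {v} = {a, b}" by (auto simp: card_2_iff)
    ultimately have "H = {v, a, b}" "a \<in> {1..n}" "b \<in> {1..n}" by blast+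
    then show "H \<in> (\<lambda>(a, b). {v, a, b}) ` ({1..n} \<times> {1..n})" by force
  qed
  then have "card (subsets_of_size 3 {1..n} \<inter> crossing {v}) \<le> card ({1..n} \<times> {1..n})"
    by (meson card_image_le card_mono finite_SigmaI finite_atLeastAtMost finite_imageI le_trans)
  then show ?thesis by (simp add: power2_eq_square)
qed

lemma card_triples_through_pair:
  assumes "u \<noteq> v"
  shows "card {H \<in> subsets_of_size 3 {1..n}. u \<in> H \<and> v \<in> H} \<le> n"
proof -
  have "{H \<in> subsets_of_size 3 {1..n}. u \<in> H \<and> v \<in> H} \<subseteq> (\<lambda>w. {u, v, w}) ` {1..n}"
  proof
    fix H assume "H \<in> {H \<in> subsets_of_size 3 {1..n}. u \<in> H \<and> v \<in> H}"
    then have H: "card H = 3" "u \<in> H" "v \<in> H" "H \<subseteq> {1..n}"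
      by (auto simp: subsets_of_size_def)
    then have "card (H - {u, v}) = 1" using assms by (subst card_Diff_subset) auto
    then obtain w where "H - {u, v} = {w}" by (auto simp: card_1_singleton_iff)
    with H have "H = {u, v, w}" "w \<in> {1..n}" by blast+
    then show "H \<in> (\<lambda>w. {u, v, w}) ` {1..n}" by blast
  qed
  then have "card {H \<in> subsets_of_size 3 {1..n}. u \<in> H \<and> v \<in> H} \<le> card {1..n}"
    by (meson card_image_le card_mono finite_atLeastAtMost finite_imageI le_trans)
  then show ?thesis by simp
qed

text \<open>Only triples with one vertex in \<open>S\<close> and two outside are counted;
  intersecting with \<open>S\<close> and removing \<open>S\<close> recover the two parts. If
  \<open>S\<close> is the smaller side, these already have the order \<open>|S| n^2\<close>.\<close>

lemma card_triples_crossing_ge: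
  assumes "finite V" "S \<subseteq> V"
  shows "card S * (card (V - S) choose 2) \<le> card (subsets_of_size 3 V \<inter> crossing S)"
proof -
  let ?D = "S \<times> subsets_of_size 2 (V - S)"
  have inj: "inj_on (\<lambda>(s, T). insert s T) ?D"
  proof (rule inj_onI, clarify)
    fix s T s' T'
    assume a: "s \<in> S" "s' \<in> S" "T \<in> subsets_of_size 2 (V - S)" "T' \<in> subsets_of_size 2 (V - S)"
      "insert s T = insert s' T'"
    then have T: "T \<inter> S = {}" "T' \<inter> S = {}" by (auto simp: subsets_of_size_def)
    have "{s} = insert s T \<inter> S" "{s'} = insert s' T' \<inter> S" using T a(1,2) by auto
    moreover have "T = insert s T - S" "T' = insert s' T' - S" using T a(1,2) by auto
    ultimately show "s = s' \<and> T = T'" using a(5) by auto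
  qed
  have "(\<lambda>(s, T). insert s T) ` ?D \<subseteq> subsets_of_size 3 V \<inter> crossing S"
  proof clarify
    fix s T assume a: "s \<in> S" "T \<in> subsets_of_size 2 (V - S)"
    then have T: "T \<subseteq> V - S" "card T = 2" by (auto simp: subsets_of_size_def)
    then have "finite T" "T \<noteq> {}" using card.infinite by fastforce+
    moreover have "s \<notin> T" using T a by blast
    ultimately have "card (insert s T) = 3" using T(2) by simp
    moreover have "insert s T \<subseteq> V" "\<not> insert s T \<subseteq> S" "insert s T \<inter> S \<noteq> {}"
      using T a assms \<open>T \<noteq> {}\<close> by blast+
    ultimately show "insert s T \<in> subsets_of_size 3 V \<inter> crossing S"
      by (auto simp: subsets_of_size_def crossing_def)
  qed
  then have "card ?D \<le> card (subsets_of_size 3 V \<inter> crossing S)"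
    using inj assms by (metis card_image card_mono finite_Int finite_subsets_of_size)
  then show ?thesis using assms by (simp add: card_cartesian_product card_subsets_of_size)
qed

section \<open>Fixed \<open>n\<close> and \<open>p\<close>: isolated vertices bound the connection
  probability from above\<close>

context
  fixes n :: nat and p :: real
  assumes p: "p \<in> {0..1}"
begin

abbreviation (input) "triples \<equiv> subsets_of_size 3 {1..n}"
abbreviation (input) "outcomes \<equiv> Pi_pmf triples None (hyperedge_choice p)"

lemma finite_triples: "finite triples" and card_triple: "H \<in> triples \<Longrightarrow> card H = 3"
  by (simp_all add: finite_subsets_of_size) (simp add: subsets_of_size_def)

lemma prob_triples_avoid:
  "measure_pmf.prob outcomes (avoids triples F) =
    (\<Prod>H\<in>triples. 1 - p * card (subsets_of_size 2 H \<inter> F) / 3)"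
  by (intro prob_avoids p finite_triples card_triple)

lemma prob_crossing:
  "measure_pmf.prob outcomes (avoids triples (crossing S)) = (1 - 2 * p / 3) ^ card (triples \<inter> crossing S)"
  by (intro prob_avoids_crossing p finite_triples card_triple)

lemma prob_isolated_ge:
  "(1 - 2 * p / 3) ^ n\<^sup>2 \<le> measure_pmf.prob outcomes (avoids triples (crossing {v}))"
  unfolding prob_crossing using p card_triples_through_vertex by (intro power_decreasing) auto

text \<open>Compare the products triple by triple, with \<open>r = 1 - 2p/3\<close>. A triple
  missing \<open>u\<close> or \<open>v\<close> contributes equally to both sides. A triple
  containing both contributes \<open>r^2\<close> on the right and at most 1 to the joint
  probability, so a compensating \<open>r^2\<close> suffices; at most \<open>n\<close> triples need
  it.\<close>

lemma prob_pair_isolated_le: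
  assumes "u \<noteq> v"
  shows "measure_pmf.prob outcomes (avoids triples (crossing {u}) \<inter> avoids triples (crossing {v})) *
      (1 - 2 * p / 3) ^ (2 * n) \<le>
    measure_pmf.prob outcomes (avoids triples (crossing {u})) *
    measure_pmf.prob outcomes (avoids triples (crossing {v}))"
proof -
  let ?f = "\<lambda>F H. 1 - p * card (subsets_of_size 2 H \<inter> F) / 3"
  let ?F = "crossing {u} \<union> crossing {v}"
  let ?r = "1 - 2 * p / 3"
  let ?B = "{H \<in> triples. u \<in> H \<and> v \<in> H}"
  have r: "0 \<le> ?r" "?r \<le> 1" using p by auto
  have f01: "0 \<le> ?f F H" "?f F H \<le> 1" if "H \<in> triples" for F H
  proof -
    have "p * card (subsets_of_size 2 H \<inter> F) \<le> 1 * 3"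
      using card_pairs_le[OF card_triple[OF that], of F] p by (intro mult_mono) auto
    then show "0 \<le> ?f F H" "?f F H \<le> 1" using p by auto
  qed
  have f_crossing: "?f (crossing {w}) H = (if w \<in> H then ?r else 1)" if "H \<in> triples" for w H
    using card_pairs_crossing[OF card_triple[OF that], of "{w}"] in_crossing_singleton[OF card_triple[OF that]]
    by simp
  have pointwise: "?f ?F H * (if H \<in> ?B then ?r\<^sup>2 else 1) \<le> ?f (crossing {u}) H * ?f (crossing {v}) H"
    if H: "H \<in> triples" for H
  proof (cases "u \<in> H \<and> v \<in> H")
    case True
    have "?f ?F H * ?r\<^sup>2 \<le> 1 * ?r\<^sup>2" using f01[OF H] by (intro mult_right_mono) auto
    with True H show ?thesis by (simp add: f_crossing power2_eq_square)
  next
    case False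
    have none: "subsets_of_size 2 H \<inter> crossing {w} = {}" if "w \<notin> H" for w
      using that by (auto simp: subsets_of_size_def crossing_def)
    from False consider "u \<notin> H" | "v \<notin> H" by blast
    then have "?f ?F H = ?f (crossing {u}) H * ?f (crossing {v}) H"
    proof cases
      case 1 then show ?thesis using none[of u] by (simp add: Int_Un_distrib)
    next
      case 2 then show ?thesis using none[of v] by (simp add: Int_Un_distrib)
    qed
    moreover have "H \<notin> ?B" using False by blast
    ultimately show ?thesis by (simp only: if_False mult_1_right order_refl)
  qed
  have "?r ^ (2 * n) \<le> ?r ^ (2 * card ?B)"
    using card_triples_through_pair[OF assms, of n] r by (intro power_decreasing) auto
  also have "\<dots> = (\<Prod>H\<in>triples. if H \<in> ?B then ?r\<^sup>2 else 1)"
    using finite_triples by (simp add: prod.If_cases power_mult Collect_conj_eq)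
  finally have "(\<Prod>H\<in>triples. ?f ?F H) * ?r ^ (2 * n) \<le>
      (\<Prod>H\<in>triples. ?f ?F H) * (\<Prod>H\<in>triples. if H \<in> ?B then ?r\<^sup>2 else 1)"
    by (intro mult_left_mono prod_nonneg f01)
  also have "\<dots> = (\<Prod>H\<in>triples. ?f ?F H * (if H \<in> ?B then ?r\<^sup>2 else 1))"
    by (rule prod.distrib[symmetric])
  also have "\<dots> \<le> (\<Prod>H\<in>triples. ?f (crossing {u}) H * ?f (crossing {v}) H)"
    using pointwise f01 by (intro prod_mono) auto
  also have "\<dots> = (\<Prod>H\<in>triples. ?f (crossing {u}) H) * (\<Prod>H\<in>triples. ?f (crossing {v}) H)"
    by (rule prod.distrib)
  finally show ?thesis
    unfolding avoids_Un[symmetric] prob_triples_avoid .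
qed

text \<open>A connected graph on at least two vertices has no isolated vertex, so the second moment
  inequality applies to the number of isolated vertices. Its mean is at least \<open>n * a\<close>,
  and its second moment at most \<open>\<mu> + \<mu>\<^sup>2 / b\<close>.\<close>

lemma prob_connected_le:
  assumes n: "n \<ge> 2"
  shows "measure_pmf.prob (random_multigraph n p triples) {G. Digraph_Component.connected G} \<le>
    1 / (n * (1 - 2 * p / 3) ^ n\<^sup>2) + 1 / (1 - 2 * p / 3) ^ (2 * n) - 1"
proof -
  let ?P = "measure_pmf.prob outcomes"
  let ?I = "\<lambda>v. avoids triples (crossing {v})"
  let ?V = "{1..n}"
  define a where "a = (1 - 2 * p / 3) ^ n\<^sup>2"
  define b where "b = (1 - 2 * p / 3) ^ (2 * n)"
  define \<mu> where "\<mu> = (\<Sum>v\<in>?V. ?P (?I v))"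
  define N where "N = {c. \<forall>v\<in>?V. c \<notin> ?I v}"
  \<comment> \<open>\<open>p \<le> 1\<close> makes the base at least 1/3, so division by
    \<open>a\<close> and \<open>b\<close> is genuine.\<close>
  have pos: "0 < a" "0 < b" using p by (auto simp: a_def b_def)
  have "n * a = (\<Sum>v\<in>?V. a)" by simp
  also have "\<dots> \<le> \<mu>" unfolding \<mu>_def a_def by (intro sum_mono prob_isolated_ge)
  finally have \<mu>: "n * a \<le> \<mu>" .
  then have \<mu>0: "\<mu> > 0" using pos n by (intro order_less_le_trans[OF _ \<mu>] mult_pos_pos) auto
  \<comment> \<open>The first summand pays for the diagonal and sums to \<open>\<mu>\<close>; the
    second is near-independence and sums to \<open>\<mu>\<^sup>2 / b\<close>.\<close>
  have pair: "?P (?I u \<inter> ?I v) \<le> (if u = v then ?P (?I u) else 0) + ?P (?I u) * ?P (?I v) / b" for u v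
  proof (cases "u = v")
    case False
    then show ?thesis
      using prob_pair_isolated_le[OF False] pos by (simp add: b_def[symmetric] pos_le_divide_eq)
  qed (use pos in simp)
  have "(\<Sum>u\<in>?V. \<Sum>v\<in>?V. ?P (?I u \<inter> ?I v)) \<le>
      (\<Sum>u\<in>?V. \<Sum>v\<in>?V. (if u = v then ?P (?I u) else 0) + ?P (?I u) * ?P (?I v) / b)"
    by (intro sum_mono pair)
  also have "\<dots> = \<mu> + \<mu>\<^sup>2 / b"
    by (simp add: sum.distrib \<mu>_def power2_eq_square sum_product sum_divide_distrib)
  finally have "\<mu>\<^sup>2 * ?P N \<le> \<mu> + \<mu>\<^sup>2 / b - \<mu>\<^sup>2"
    using second_moment_pmf[where V = ?V and M = outcomes and I = ?I] by (simp add: \<mu>_def N_def)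
  then have "?P N \<le> (\<mu> + \<mu>\<^sup>2 / b - \<mu>\<^sup>2) / \<mu>\<^sup>2"
    using \<mu>0 by (simp add: pos_le_divide_eq mult.commute)
  also have "\<dots> = 1 / \<mu> + 1 / b - 1"
    using \<mu>0 by (simp add: add_divide_distrib diff_divide_distrib power2_eq_square)
  also have "1 / \<mu> \<le> 1 / (n * a)"
    using \<mu> \<mu>0 pos n by (intro divide_left_mono) auto
  finally have N: "?P N \<le> 1 / (n * a) + 1 / b - 1" by simp
  \<comment> \<open>\<open>n \<ge> 2\<close> makes \<open>{v}\<close> a proper subset, hence one of
    the cuts in the connectivity criterion.\<close>
  have single: "{v} \<subset> ?V" if "v \<in> ?V" for v
  proof -
    have "card {v} \<noteq> card ?V" using n by simp
    then have "{v} \<noteq> ?V" by metis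
    then show ?thesis using that by blast
  qed
  have "measure_pmf.prob (random_multigraph n p triples) {G. Digraph_Component.connected G} =
      ?P (multigraph_of n triples -` {G. Digraph_Component.connected G})"
    by (simp add: random_multigraph_def)
  also have "\<dots> \<le> ?P N"
  proof (rule measure_pmf.finite_measure_mono_AE)
    have "c \<in> N"
      if c: "c \<in> set_pmf outcomes" "Digraph_Component.connected (multigraph_of n triples c)" for c
      unfolding N_def mem_Collect_eq
    proof
      fix v assume "v \<in> ?V"
      then show "c \<notin> ?I v"
        using connected_multigraph_iff[OF c(1)] c(2) single[of v] by blast
    qed
    then show "AE c in outcomes. c \<in> multigraph_of n triples -` {G. Digraph_Component.connected G} \<longrightarrow> c \<in> N"
      unfolding AE_measure_pmf_iff by blast
  qed simp
  finally show ?thesis using N by (simp add: a_def b_def)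
qed

section \<open>Fixed \<open>n\<close> and \<open>p\<close>: the union bound over cuts from
  below\<close>

lemma prob_crossing_le:
  assumes n: "n \<ge> 4" and S: "S \<subseteq> {1..n}" "2 * card S \<le> n"
  shows "measure_pmf.prob outcomes (avoids triples (crossing S)) \<le> exp (- p * n\<^sup>2 / 24) ^ card S"
proof -
  let ?k = "card S" and ?K = "card (triples \<inter> crossing S)"
  have fS: "finite S" using S(1) finite_subset by blast
  define m where "m = card ({1..n} - S)"
  have m: "m = n - ?k" unfolding m_def using S fS by (simp add: card_Diff_subset)
  have m2: "real n / 2 \<le> m" using m S by simp
  have "real (m choose 2) = m * (real m - 1) / 2"
  proof -
    have "2 * (m choose 2) = m * (m - 1)" unfolding choose_two by (intro dvd_mult_div_cancel) auto
    then have "2 * real (m choose 2) = real m * real (m - 1)"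
      by (metis of_nat_mult of_nat_numeral)
    moreover have "m \<ge> 1" using m2 n by linarith
    ultimately show ?thesis by (simp add: of_nat_diff)
  qed
  \<comment> \<open>From \<open>n \<ge> 4\<close> follows
    \<open>m - 1 \<ge> n/2 - 1 \<ge> n/4\<close>.\<close>
  also have "\<dots> \<ge> (real n / 2) * (real n / 4) / 2"
    using m2 n by (intro divide_right_mono mult_mono) auto
  finally have "real ?k * (n\<^sup>2 / 16) \<le> real ?k * real (m choose 2)"
    by (intro mult_left_mono) (simp_all add: power2_eq_square)
  also have "\<dots> \<le> ?K"
    using card_triples_crossing_ge[of "{1..n}" S] S(1) unfolding m_def[symmetric]
    by (simp flip: of_nat_mult)
  finally have K: "real ?k * (n\<^sup>2 / 16) \<le> ?K" .
  \<comment> \<open>By \<open>1 - x \<le> exp (- x)\<close>; the constant 24 then comes from (2/3) *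
    (1/16) = 1/24.\<close>
  have "(1 - 2 * p / 3) ^ ?K \<le> exp (- (2 * p / 3)) ^ ?K"
    using p exp_minus_ge[of "2 * p / 3"] by (intro power_mono) auto
  also have "\<dots> = exp (- (2 * p / 3) * ?K)"
    by (simp add: exp_of_nat_mult[symmetric] mult.commute)
  also have "\<dots> \<le> exp (- (2 * p / 3) * (real ?k * (n\<^sup>2 / 16)))"
    using K p by (intro iffD2[OF exp_le_cancel_iff] mult_left_mono_neg) auto
  also have "\<dots> = exp (?k * (- p * n\<^sup>2 / 24))"
    by (simp add: field_simps)
  also have "\<dots> = exp (- p * n\<^sup>2 / 24) ^ ?k"
    by (rule exp_of_nat_mult)
  finally show ?thesis unfolding prob_crossing .
qed

lemma prob_connected_ge:
  assumes n: "n \<ge> 4"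
  shows "2 - (1 + exp (- p * n\<^sup>2 / 24)) ^ n \<le>
    measure_pmf.prob (random_multigraph n p triples) {G. Digraph_Component.connected G}"
proof -
  let ?P = "measure_pmf.prob outcomes"
  let ?C = "multigraph_of n triples -` {G. Digraph_Component.connected G}"
  let ?y = "exp (- p * n\<^sup>2 / 24)"
  \<comment> \<open>Every cut has a side with at most half of the vertices, so these sets represent
    all cuts.\<close>
  define \<S> where "\<S> = {S. S \<subseteq> {1..n} \<and> S \<noteq> {} \<and> 2 * card S \<le> n}"
  have fin: "finite \<S>" by (rule finite_subset[of _ "Pow {1..n}"]) (auto simp: \<S>_def)
  have "?P (- ?C) \<le> ?P (\<Union>S\<in>\<S>. avoids triples (crossing S))"
  proof (rule measure_pmf.finite_measure_mono_AE)
    have "\<exists>S\<in>\<S>. c \<in> avoids triples (crossing S)" if c: "c \<in> set_pmf outcomes" "c \<notin> ?C" for c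
    proof -
      obtain S where S: "S \<subset> {1..n}" "S \<noteq> {}" "c \<in> avoids triples (crossing S)"
        using c connected_multigraph_iff[OF c(1)] n by auto
      have fS: "finite S" using S(1) finite_subset by blast
      let ?T = "{1..n} - S"
      have cT: "card ?T = n - card S" using S fS by (simp add: card_Diff_subset)
      \<comment> \<open>\<open>crossing S\<close> and \<open>crossing ?T\<close> differ as families
        of arbitrary sets but agree on subsets of \<open>{1..n}\<close>, and on the support all
        edges are such subsets.\<close>
      have "c \<in> avoids triples (crossing ?T)"
        unfolding avoids_def
      proof (clarify)
        fix H e assume H: "H \<in> triples" and e: "e \<in> crossing ?T" "c H = Some e"
        have "Some e \<in> set_pmf (hyperedge_choice p H)"
          using c(1) H e finite_triples by (force simp: set_Pi_pmf PiE_dflt_def)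
        then have "e \<subseteq> {1..n}"
          using hyperedge_choice_support(1)[OF card_triple[OF H]] H by (auto simp: subsets_of_size_def)
        with e have "e \<in> crossing S" by (auto simp: crossing_def)
        with S(3) H e(2) show False by (auto simp: avoids_def)
      qed
      moreover have "S \<in> \<S> \<or> ?T \<in> \<S>"
        using S cT unfolding \<S>_def by auto
      ultimately show ?thesis using S(3) by blast
    qed
    then show "AE c in outcomes. c \<in> - ?C \<longrightarrow> c \<in> (\<Union>S\<in>\<S>. avoids triples (crossing S))"
      unfolding AE_measure_pmf_iff by blast
  qed simp
  also have "\<dots> \<le> (\<Sum>S\<in>\<S>. ?P (avoids triples (crossing S)))"
    using fin by (intro measure_pmf.finite_measure_subadditive_finite) auto
  also have "\<dots> \<le> (\<Sum>S\<in>\<S>. ?y ^ card S)"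
    using n by (intro sum_mono prob_crossing_le) (auto simp: \<S>_def)
  also have "\<dots> \<le> (\<Sum>S\<in>Pow {1..n} - {{}}. ?y ^ card S)"
    by (intro sum_mono2) (auto simp: \<S>_def)
  also have "\<dots> = (\<Sum>S\<in>Pow {1..n}. ?y ^ card S) - 1"
    by (subst sum_diff1) auto
  \<comment> \<open>Expanding the product, each vertex chooses \<open>?y\<close> if it is in
    \<open>S\<close> and 1 otherwise.\<close>
  also have "(\<Sum>S\<in>Pow {1..n}. ?y ^ card S) = (\<Prod>v\<in>{1..n}. ?y + 1)"
    by (subst prod_add) simp_all
  finally have "?P (- ?C) \<le> (1 + ?y) ^ n - 1"
    by (simp add: add.commute)
  moreover have "?P (- ?C) = 1 - ?P ?C"
    using measure_pmf.prob_compl[of ?C outcomes] by (simp add: Compl_eq_Diff_UNIV)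
  ultimately show ?thesis by (simp add: random_multigraph_def)
qed

end

section \<open>Limits on the two sides of the threshold\<close>

lemma exp_le_one_minus:
  fixes t :: real
  assumes "0 \<le> t" "t \<le> 1 / 2"
  shows "exp (- 2 * t) \<le> 1 - t"
proof -
  \<comment> \<open>The product is \<open>1 + t - 2 t^2\<close>, at least 1 because
    \<open>t \<le> 1/2\<close>.\<close>
  have "1 \<le> (1 - t) * (1 + 2 * t)"
    using mult_left_mono[of t "1 / 2" t] assms by (simp add: algebra_simps)
  also have "\<dots> \<le> (1 - t) * exp (2 * t)"
    using assms by (intro mult_left_mono) auto
  finally show ?thesis by (simp add: exp_minus divide_simps)
qed

theorem theorem1p8:
  fixes p :: "nat \<Rightarrow> real"
  assumes p: "\<And>n. p n \<in> {0..1}"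
  shows "(p \<lless> (\<lambda>n. ln (real n) / real n ^ 2) \<longrightarrow>
           (\<lambda>n. measure_pmf.prob (random_multigraph n (p n) (subsets_of_size 3 {1..n}))
                  {G. Digraph_Component.connected G}) \<longlonglongrightarrow> 0) \<and>
         ((\<lambda>n. ln (real n) / real n ^ 2) \<lless> p \<longrightarrow>
           (\<lambda>n. measure_pmf.prob (random_multigraph n (p n) (subsets_of_size 3 {1..n}))
                  {G. Digraph_Component.connected G}) \<longlonglongrightarrow> 1)"
    (is "(_ \<longrightarrow> ?P \<longlonglongrightarrow> 0) \<and> (_ \<longrightarrow> _)")
proof (intro conjI impI)
  let ?t = "\<lambda>n. ln (real n) / real n ^ 2"
  assume "p \<lless> ?t"
  then have lim: "(\<lambda>n. p n / ?t n) \<longlonglongrightarrow> 0" by (simp add: much_less_def)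
  \<comment> \<open>The constant 3/8 turns the exponent \<open>4/3 * p n * n\<^sup>2\<close> below
    into at most \<open>ln n / 2\<close>, so a vertex is isolated with probability at least
    \<open>1 / sqrt n\<close>.\<close>
  have small: "\<forall>\<^sub>F n in sequentially. p n * n\<^sup>2 \<le> 3 / 8 * ln n"
    using order_tendstoD(2)[OF lim, of "3 / 8", simplified] eventually_gt_at_top[of 1]
    by eventually_elim (simp add: field_simps)
  have "(\<lambda>n. (p n / ?t n) * (ln n / n)) \<longlonglongrightarrow> 0 * 0"
    by (intro tendsto_mult lim lim_ln_over_n)
  moreover have "\<forall>\<^sub>F n in sequentially. (p n / ?t n) * (ln n / n) = p n * n"
    using eventually_gt_at_top[of 1] by eventually_elim (simp add: field_simps power2_eq_square)
  ultimately have pn: "(\<lambda>n. p n * n) \<longlonglongrightarrow> 0"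
    by (simp add: tendsto_cong)
  have "(\<lambda>n. 1 - 4 / 3 * (p n * n)) \<longlonglongrightarrow> 1 - 4 / 3 * 0"
    by (intro tendsto_intros pn)
  then have b1: "(\<lambda>n. 1 - 4 / 3 * (p n * n)) \<longlonglongrightarrow> 1" by simp
  have s0: "(\<lambda>n. 1 / sqrt (real n)) \<longlonglongrightarrow> 0"
    using tendsto_inverse_0_at_top[OF filterlim_compose[OF sqrt_at_top filterlim_real_sequentially]]
    by (simp add: inverse_eq_divide)
  have "(\<lambda>n. 1 / sqrt n + 1 / (1 - 4 / 3 * (p n * n)) - 1) \<longlonglongrightarrow> 0 + 1 / 1 - 1"
    by (intro tendsto_intros s0 b1) simp
  then have upper: "(\<lambda>n. 1 / sqrt n + 1 / (1 - 4 / 3 * (p n * n)) - 1) \<longlonglongrightarrow> 0" by simp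
  \<comment> \<open>This keeps the denominator positive and also forces
    \<open>p n \<le> 3/4\<close>, so that \<open>exp_le_one_minus\<close> applies to
    \<open>t = 2 * p n / 3\<close>.\<close>
  have half: "\<forall>\<^sub>F n in sequentially. 1 / 2 < 1 - 4 / 3 * (p n * n)"
    by (rule order_tendstoD(1)[OF b1]) simp
  have bound: "\<forall>\<^sub>F n in sequentially. ?P n \<le> 1 / sqrt n + 1 / (1 - 4 / 3 * (p n * n)) - 1"
    using small eventually_ge_at_top[of 2] half
  proof eventually_elim
    case (elim n)
    have p01: "0 \<le> p n" "p n \<le> 1" using p[of n] by auto
    have n2: "n \<ge> 2" using elim(2) .
    have pn2: "p n \<le> 3 / 4"
    proof -
      have "p n * 2 \<le> p n * n" using p01 n2 by (intro mult_left_mono) auto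
      with elim(3) show ?thesis by simp
    qed
    have "1 / sqrt n = exp (- (ln n / 2))"
      using n2 by (simp add: exp_minus powr_half_sqrt[symmetric] powr_def field_simps)
    also have "\<dots> \<le> exp (n\<^sup>2 * (- 2 * (2 * p n / 3)))"
      using elim(1) by (simp add: field_simps)
    also have "\<dots> = exp (- 2 * (2 * p n / 3)) ^ n\<^sup>2"
      by (subst exp_of_nat_mult) simp
    also have "\<dots> \<le> (1 - 2 * p n / 3) ^ n\<^sup>2"
      using p01 pn2 by (intro power_mono exp_le_one_minus) auto
    finally have "n * (1 / sqrt n) \<le> n * (1 - 2 * p n / 3) ^ n\<^sup>2"
      by (intro mult_left_mono) auto
    \<comment> \<open>The expected number of isolated vertices is thus at least
      \<open>sqrt n\<close>, which tends to infinity.\<close>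
    then have sq: "sqrt n \<le> n * (1 - 2 * p n / 3) ^ n\<^sup>2"
      using n2 by (simp add: real_div_sqrt)
    \<comment> \<open>Bernoulli's inequality: the correlation factor tends to 1 because
      \<open>p n * n\<close> tends to 0.\<close>
    have "1 + real (2 * n) * (- (2 * p n / 3)) \<le> (1 + - (2 * p n / 3)) ^ (2 * n)"
      using p01 by (intro Bernoulli_inequality) auto
    then have be: "1 - 4 / 3 * (p n * n) \<le> (1 - 2 * p n / 3) ^ (2 * n)"
      by (simp add: algebra_simps)
    have "?P n \<le> 1 / (n * (1 - 2 * p n / 3) ^ n\<^sup>2) + 1 / (1 - 2 * p n / 3) ^ (2 * n) - 1"
      by (rule prob_connected_le[OF p n2])
    also have "\<dots> \<le> 1 / sqrt n + 1 / (1 - 4 / 3 * (p n * n)) - 1"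
      using sq be elim(3) n2 p01
      by (intro diff_mono add_mono divide_left_mono mult_pos_pos zero_less_power) auto
    finally show ?case .
  qed
  show "?P \<longlonglongrightarrow> 0"
    by (rule tendsto_sandwich[OF _ bound tendsto_const upper]) simp
next
  let ?t = "\<lambda>n. ln (real n) / real n ^ 2"
  assume "?t \<lless> p"
  then have lim: "(\<lambda>n. ?t n / p n) \<longlonglongrightarrow> 0" and nz: "\<forall>\<^sub>F n in sequentially. p n \<noteq> 0"
    by (simp_all add: much_less_def)
  \<comment> \<open>With 1/48, \<open>p n * n\<^sup>2 / 24\<close> exceeds \<open>2 * ln n\<close>,
    so each vertex of \<open>S\<close> contributes a factor of at most \<open>1 / n^2\<close>, and
    \<open>(1 + 1/n^2)^n \<le> exp (1/n)\<close>.\<close>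
  have large: "\<forall>\<^sub>F n in sequentially. ?t n / p n < 1 / 48"
    by (rule order_tendstoD(2)[OF lim]) simp
  have "(\<lambda>n. 2 - exp (1 / real n)) \<longlonglongrightarrow> 2 - exp 0"
    by (intro tendsto_intros lim_1_over_n)
  then have lower: "(\<lambda>n. 2 - exp (1 / real n)) \<longlonglongrightarrow> 1" by simp
  have bound: "\<forall>\<^sub>F n in sequentially. 2 - exp (1 / real n) \<le> ?P n"
    using large nz eventually_ge_at_top[of 4]
  proof eventually_elim
    case (elim n)
    have n4: "n \<ge> 4" using elim(3) .
    \<comment> \<open>The nonvanishing part of \<open>\<lless>\<close> matters here: at
      \<open>p n = 0\<close> the quotient would be 0 by convention and \<open>large\<close> would
      say nothing.\<close>
    have p0: "p n > 0" using p[of n] elim(2) by auto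
    have "2 * ln n \<le> p n * n\<^sup>2 / 24"
      using elim(1) p0 n4 by (simp add: field_simps)
    then have "exp (- p n * n\<^sup>2 / 24) \<le> exp (- (2 * ln n))" by simp
    also have "\<dots> = 1 / real n ^ 2"
      using n4 by (simp add: exp_minus exp_double exp_ln_iff field_simps)
    finally have "1 + exp (- p n * n\<^sup>2 / 24) \<le> 1 + 1 / real n ^ 2"
      by (rule add_left_mono)
    also have "\<dots> \<le> exp (1 / real n ^ 2)"
      by (rule exp_ge_add_one_self)
    finally have "(1 + exp (- p n * n\<^sup>2 / 24)) ^ n \<le> exp (1 / real n ^ 2) ^ n"
      by (rule power_mono) (simp add: add_nonneg_nonneg)
    also have "\<dots> = exp (n * (1 / real n ^ 2))"
      by (rule exp_of_nat_mult[symmetric])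
    also have "\<dots> = exp (1 / n)"
      by (simp add: power2_eq_square)
    finally have "2 - exp (1 / real n) \<le> 2 - (1 + exp (- p n * n\<^sup>2 / 24)) ^ n"
      by simp
    also have "\<dots> \<le> ?P n"
      by (rule prob_connected_ge[OF p n4])
    finally show ?case .
  qed
  show "?P \<longlonglongrightarrow> 1"
    by (rule tendsto_sandwich[OF bound _ lower tendsto_const]) simp
qed

end
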